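(* In two-pile Sharing Nim, the first player to move has a winning strategy if the starting position has nonzero nim-sum, and the second player has a winning strategy if the starting position has nim-sum $0$; the winning strategy is the same as in ordinary two-pile Nim, namely always to move to a position of nim-sum $0$.
   Context: Sharing Nim (here with 2 piles): a position is a tuple of nonnegative integers (pile sizes). Two players alternate moves. A move is either (a) removing a positive number of objects from one pile, or (b) transferring a positive number of objects from one pile to another pile, subject to the restriction that objects may not be transferred from a pile of greater size to a pile of smaller size. The player who removes the last object wins (a player with no legal move loses). The nim-sum is the bitwise exclusive-or of the pile sizes. In ordinary Nim a move consists only of removing a positive number of objects from one pile. *)

theory Defs
  imports Main
begin

text \<open>
  A game is given by its move relation \<open>M\<close> (normal play: a player without a legal move loses).
  A play is recorded by the positions visited; the player to move at index \<open>i\<close> is the first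
  player iff \<open>i\<close> is even.
\<close>

datatype player = First | Second

definition on_move :: "nat \<Rightarrow> player" where
  "on_move i = (if even i then First else Second)"

definition finite_play :: "('p \<Rightarrow> 'p \<Rightarrow> bool) \<Rightarrow> 'p \<Rightarrow> 'p list \<Rightarrow> bool" where
  "finite_play M p ps \<longleftrightarrow>
     ps \<noteq> [] \<and> hd ps = p \<and> (\<forall>i. Suc i < length ps \<longrightarrow> M (ps ! i) (ps ! Suc i))"

definition infinite_play :: "('p \<Rightarrow> 'p \<Rightarrow> bool) \<Rightarrow> 'p \<Rightarrow> (nat \<Rightarrow> 'p) \<Rightarrow> bool" where
  "infinite_play M p f \<longleftrightarrow> f 0 = p \<and> (\<forall>i. M (f i) (f (Suc i)))"

text \<open>A strategy \<open>\<sigma>\<close> is positional: \<open>\<sigma> q\<close> is the position its owner \<open>w\<close> moves to from \<open>q\<close>.\<close>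

definition finite_play_follows :: "('p \<Rightarrow> 'p) \<Rightarrow> player \<Rightarrow> 'p list \<Rightarrow> bool" where
  "finite_play_follows \<sigma> w ps \<longleftrightarrow>
     (\<forall>i. Suc i < length ps \<and> on_move i = w \<longrightarrow> ps ! Suc i = \<sigma> (ps ! i))"

definition infinite_play_follows :: "('p \<Rightarrow> 'p) \<Rightarrow> player \<Rightarrow> (nat \<Rightarrow> 'p) \<Rightarrow> bool" where
  "infinite_play_follows \<sigma> w f \<longleftrightarrow> (\<forall>i. on_move i = w \<longrightarrow> f (Suc i) = \<sigma> (f i))"

definition terminal :: "('p \<Rightarrow> 'p \<Rightarrow> bool) \<Rightarrow> 'p \<Rightarrow> bool" where
  "terminal M q \<longleftrightarrow> \<not> (\<exists>r. M q r)"

text \<open>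
  Legality is only required at positions that arise, with \<open>w\<close> to move, in plays from \<open>p\<close> in
  which \<open>w\<close> follows \<open>\<sigma>\<close>; the values of \<open>\<sigma>\<close> elsewhere are irrelevant.
\<close>

definition legal_strategy :: "('p \<Rightarrow> 'p \<Rightarrow> bool) \<Rightarrow> 'p \<Rightarrow> player \<Rightarrow> ('p \<Rightarrow> 'p) \<Rightarrow> bool" where
  "legal_strategy M p w \<sigma> \<longleftrightarrow>
     (\<forall>ps. finite_play M p ps \<and> finite_play_follows \<sigma> w ps \<and>
           on_move (length ps - 1) = w \<and> \<not> terminal M (last ps) \<longrightarrow>
           M (last ps) (\<sigma> (last ps)))"

definition winning_strategy :: "('p \<Rightarrow> 'p \<Rightarrow> bool) \<Rightarrow> 'p \<Rightarrow> player \<Rightarrow> ('p \<Rightarrow> 'p) \<Rightarrow> bool" where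
  "winning_strategy M p w \<sigma> \<longleftrightarrow>
     legal_strategy M p w \<sigma> \<and>
     \<not> (\<exists>f. infinite_play M p f \<and> infinite_play_follows \<sigma> w f) \<and>
     (\<forall>ps. finite_play M p ps \<and> finite_play_follows \<sigma> w ps \<and> terminal M (last ps) \<longrightarrow>
           on_move (length ps - 1) \<noteq> w)"

type_synonym position = "nat \<times> nat"

inductive nim_move :: "position \<Rightarrow> position \<Rightarrow> bool" where
  remove_left: "0 < k \<Longrightarrow> k \<le> a \<Longrightarrow> nim_move (a, b) (a - k, b)"
| remove_right: "0 < k \<Longrightarrow> k \<le> b \<Longrightarrow> nim_move (a, b) (a, b - k)"

text \<open>The sizes compared in a transfer are those before the move; equal piles may share.\<close>

inductive sharing_nim_move :: "position \<Rightarrow> position \<Rightarrow> bool" where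
  remove: "nim_move p q \<Longrightarrow> sharing_nim_move p q"
| transfer_to_right:
    "0 < k \<Longrightarrow> k \<le> a \<Longrightarrow> a \<le> b \<Longrightarrow> sharing_nim_move (a, b) (a - k, b + k)"
| transfer_to_left:
    "0 < k \<Longrightarrow> k \<le> b \<Longrightarrow> b \<le> a \<Longrightarrow> sharing_nim_move (a, b) (a + k, b - k)"

definition nim_sum :: "position \<Rightarrow> nat" where
  "nim_sum p = Bit_Operations.xor (fst p) (snd p)"

text \<open>Moving to nim-sum 0 is only demanded where the nim-sum is not already 0.\<close>

definition moves_to_nim_sum_0 ::
    "(position \<Rightarrow> position \<Rightarrow> bool) \<Rightarrow> (position \<Rightarrow> position) \<Rightarrow> bool" where
  "moves_to_nim_sum_0 M \<sigma> \<longleftrightarrow>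
     (\<forall>q. nim_sum q \<noteq> 0 \<longrightarrow> M q (\<sigma> q) \<and> nim_sum (\<sigma> q) = 0)"

end

theory Submission imports Defs begin

text \<open>
  In two-pile positions nim-sum 0 means equal piles. No move keeps equal piles equal. A transfer
  increases the difference of the piles, hence never equalises them, so the moves to nim-sum 0
  are exactly those of ordinary Nim: cut the larger pile down to the smaller. Play ends because
  a removal lowers the total, and a transfer keeps the total while lowering the smaller pile.
\<close>

text \<open>While \<open>w\<close> follows \<open>\<sigma>\<close>, \<open>w\<close> is to move
  exactly outside \<open>Z\<close>: \<open>\<sigma>\<close> enters \<open>Z\<close> and any reply
  leaves it. The hypothesis on \<open>w\<close> starts this alternation correctly for either player.
  The move relation stays abstract so that both games are covered.\<close>

lemma winning_strategy_if_invariant: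
  assumes wf: "wfp (\<lambda>r q. M q r)"
    and leave: "\<And>q r. Z q \<Longrightarrow> M q r \<Longrightarrow> \<not> Z r"
    and enter: "\<And>q. \<not> Z q \<Longrightarrow> M q (\<sigma> q) \<and> Z (\<sigma> q)"
    and w: "w = First \<longleftrightarrow> \<not> Z p"
  shows "winning_strategy M p w \<sigma>"
proof -
  have mover: "on_move (length ps - 1) = w \<longleftrightarrow> \<not> Z (last ps)"
    if play: "finite_play M p ps" and follows: "finite_play_follows \<sigma> w ps" for ps
  proof -
    have "on_move i = w \<longleftrightarrow> \<not> Z (ps ! i)" if "i < length ps" for i
      using that
    proof (induction i)
      case 0
      then show ?case
        using play w by (auto simp: on_move_def finite_play_def hd_conv_nth)
    next
      case (Suc i)
      have step: "M (ps ! i) (ps ! Suc i)"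
        using play Suc.prems by (auto simp: finite_play_def)
      have IH: "on_move i = w \<longleftrightarrow> \<not> Z (ps ! i)"
        using Suc by simp
      have alternate: "on_move (Suc i) = w \<longleftrightarrow> on_move i \<noteq> w"
        by (cases w) (auto simp: on_move_def)
      show ?case
      proof (cases "on_move i = w")
        case True
        then have "ps ! Suc i = \<sigma> (ps ! i)"
          using follows Suc.prems by (auto simp: finite_play_follows_def)
        then show ?thesis
          using IH True alternate enter by simp
      next
        case False
        then show ?thesis
          using IH alternate leave step by blast
      qed
    qed
    then show ?thesis
      using play by (simp add: finite_play_def last_conv_nth)
  qed
  \<comment> \<open>Infinite plays are excluded whether or not \<open>\<sigma>\<close> is
    followed.\<close>
  have "\<not> infinite_play M p f" for f
  proof
    assume "infinite_play M p f"
    then have "\<forall>i. (f (Suc i), f i) \<in> {(r, q). M q r}"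
      by (simp add: infinite_play_def)
    then show False
      using wf unfolding wfp_def wf_iff_no_infinite_down_chain by blast
  qed
  \<comment> \<open>So a play can only end inside \<open>Z\<close>, where by \<open>mover\<close>
    the opponent of \<open>w\<close> is stuck.\<close>
  moreover have "\<not> terminal M q" if "\<not> Z q" for q
    using enter[OF that] by (auto simp: terminal_def)
  ultimately show ?thesis
    unfolding winning_strategy_def legal_strategy_def
    using mover enter by blast
qed

lemma nim_sum_eq_0_iff: "nim_sum (a, b) = 0 \<longleftrightarrow> a = b"
proof
  assume "nim_sum (a, b) = 0"
  then have "bit (Bit_Operations.xor a b) n = bit (0::nat) n" for n
    by (simp add: nim_sum_def)
  then show "a = b"
    by (intro bit_eqI) (simp add: bit_xor_iff)
qed (simp add: nim_sum_def)

lemma nim_move_to_smaller: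
  assumes "a \<noteq> b"
  shows "nim_move (a, b) (min a b, min a b)"
proof (cases "a < b")
  case True
  then show ?thesis
    using nim_move.remove_right[of "b - a" b a] by simp
next
  case False
  then show ?thesis
    using assms nim_move.remove_left[of "a - b" a b] by simp
qed

lemma sharing_nim_move_from_nim_sum_0:
  "sharing_nim_move q r \<Longrightarrow> nim_sum q = 0 \<Longrightarrow> nim_sum r \<noteq> 0"
  by (rule notI) (auto simp: nim_sum_eq_0_iff elim!: sharing_nim_move.cases nim_move.cases)

text \<open>Here the restriction on transfers is essential: passing 2 objects from 5 to 1 would give
  the equal piles (3, 3).\<close>

lemma sharing_nim_move_to_nim_sum_0:
  "sharing_nim_move q r \<Longrightarrow> nim_sum r = 0 \<Longrightarrow> nim_move q r"
  by (auto simp: nim_sum_eq_0_iff elim!: sharing_nim_move.cases)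

lemma wfp_sharing_nim_move: "wfp (\<lambda>r q. sharing_nim_move q r)"
proof -
  \<comment> \<open>The order is lexicographic. The source of a transfer has size
    \<open>min a b\<close>, also in a tie, and shrinks by \<open>k\<close>.\<close>
  have "{(r, q). sharing_nim_move q r}
      \<subseteq> measures [\<lambda>(a, b). a + b, \<lambda>(a, b). min a b]"
    by (auto elim!: sharing_nim_move.cases nim_move.cases)
  then show ?thesis
    unfolding wfp_def using wf_measures wf_subset by blast
qed

lemma wfp_nim_move: "wfp (\<lambda>r q. nim_move q r)"
  using wfp_sharing_nim_move by (rule wfp_subset) (auto intro: sharing_nim_move.remove)

text \<open>This makes precise that the strategy is the same in both games: they have the same moves
  into nim-sum 0.\<close>

lemma moves_to_nim_sum_0_sharing_iff:
  "moves_to_nim_sum_0 sharing_nim_move \<sigma> \<longleftrightarrow> moves_to_nim_sum_0 nim_move \<sigma>"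
  unfolding moves_to_nim_sum_0_def
  using sharing_nim_move.remove sharing_nim_move_to_nim_sum_0 by blast

lemma ex_moves_to_nim_sum_0: "\<exists>\<sigma>. moves_to_nim_sum_0 nim_move \<sigma>"
proof
  \<comment> \<open>On equal piles this function returns the position itself, which is no move;
    nothing is demanded there.\<close>
  show "moves_to_nim_sum_0 nim_move (\<lambda>(a, b). (min a b, min a b))"
    by (auto simp: moves_to_nim_sum_0_def nim_sum_eq_0_iff nim_move_to_smaller
        simp del: neq0_conv)
qed

lemma winning_strategy_sharing_nim:
  assumes "moves_to_nim_sum_0 sharing_nim_move \<sigma>" and "w = First \<longleftrightarrow> nim_sum p \<noteq> 0"
  shows "winning_strategy sharing_nim_move p w \<sigma>"
  using wfp_sharing_nim_move
  by (rule winning_strategy_if_invariant[where Z = "\<lambda>q. nim_sum q = 0"])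
    (use assms sharing_nim_move_from_nim_sum_0 in \<open>auto simp: moves_to_nim_sum_0_def\<close>)

lemma winning_strategy_nim:
  assumes "moves_to_nim_sum_0 nim_move \<sigma>" and "w = First \<longleftrightarrow> nim_sum p \<noteq> 0"
  shows "winning_strategy nim_move p w \<sigma>"
  \<comment> \<open>Moves of ordinary Nim leave nim-sum 0 because they are also moves of Sharing
    Nim.\<close>
  using wfp_nim_move
  by (rule winning_strategy_if_invariant[where Z = "\<lambda>q. nim_sum q = 0"])
    (use assms sharing_nim_move_from_nim_sum_0[OF sharing_nim_move.remove]
      in \<open>auto simp: moves_to_nim_sum_0_def\<close>)

theorem theorem5p3:
  fixes p :: position
  shows "(nim_sum p \<noteq> 0 \<longrightarrow> (\<exists>\<sigma>. winning_strategy sharing_nim_move p First \<sigma>)) \<and>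
    (nim_sum p = 0 \<longrightarrow> (\<exists>\<sigma>. winning_strategy sharing_nim_move p Second \<sigma>)) \<and>
    (\<exists>\<sigma>. moves_to_nim_sum_0 sharing_nim_move \<sigma>) \<and>
    (\<forall>\<sigma>. moves_to_nim_sum_0 sharing_nim_move \<sigma> \<longleftrightarrow> moves_to_nim_sum_0 nim_move \<sigma>) \<and>
    (\<forall>\<sigma>. moves_to_nim_sum_0 sharing_nim_move \<sigma> \<longrightarrow>
      (nim_sum p \<noteq> 0 \<longrightarrow>
         winning_strategy sharing_nim_move p First \<sigma> \<and> winning_strategy nim_move p First \<sigma>) \<and>
      (nim_sum p = 0 \<longrightarrow>
         winning_strategy sharing_nim_move p Second \<sigma> \<and> winning_strategy nim_move p Second \<sigma>))"
proof -
  \<comment> \<open>Leaving \<open>w\<close> open treats both players at once; for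
    \<open>Second\<close> the condition on \<open>w\<close> amounts to
    \<open>nim_sum p = 0\<close>.\<close>
  have win: "winning_strategy sharing_nim_move p w \<sigma> \<and> winning_strategy nim_move p w \<sigma>"
    if "moves_to_nim_sum_0 sharing_nim_move \<sigma>" "w = First \<longleftrightarrow> nim_sum p \<noteq> 0" for w \<sigma>
    using that winning_strategy_sharing_nim winning_strategy_nim moves_to_nim_sum_0_sharing_iff
    by blast
  obtain \<tau> where \<tau>: "moves_to_nim_sum_0 sharing_nim_move \<tau>"
    using ex_moves_to_nim_sum_0 moves_to_nim_sum_0_sharing_iff by blast
  show ?thesis
  proof (intro conjI allI impI)
    show "\<exists>\<sigma>. winning_strategy sharing_nim_move p First \<sigma>" if "nim_sum p \<noteq> 0"
      using win[OF \<tau>] that by blast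
    show "\<exists>\<sigma>. winning_strategy sharing_nim_move p Second \<sigma>" if "nim_sum p = 0"
      using win[OF \<tau>, of Second] that by blast
    show "\<exists>\<sigma>. moves_to_nim_sum_0 sharing_nim_move \<sigma>"
      using \<tau> by blast
  qed (use win moves_to_nim_sum_0_sharing_iff in simp_all)
qed

end
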